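(* Consider the semidiscrete scheme consisting, for every element $e\in\mathcal{E}$, of $$M_J \frac{d p}{dt} + S_x v_x + S_y v_y = -\sum_{g\in\mathcal{G}^e} (L^g)^T S_J^g W^g\,(v_n^* - v_n^-),$$ $$M_J \frac{d v_x}{dt} - S_x^T p = -\sum_{g\in\mathcal{G}^e} (L^g)^T n_x^{-g} S_J^g W^g\, p^*,$$ $$M_J \frac{d v_y}{dt} - S_y^T p = -\sum_{g\in\mathcal{G}^e} (L^g)^T n_y^{-g} S_J^g W^g\, p^*,$$ with periodic boundary conditions and with all matrices and fluxes as defined in the context. Suppose that every element $e\in\mathcal{E}$ satisfies, for all $v_x,v_y\in V_h^e$ (with coefficient vectors also denoted $v_x,v_y$), both the discrete divergence theorem $$\mathbf{1}^T S_x v_x + \mathbf{1}^T S_y v_y = \int_{\partial\hat e} S_J\,(n_x v_x + n_y v_y)$$ and the surface consistency condition $$\int_{\partial\hat e} S_J\,(n_x v_x + n_y v_y) = \sum_{g\in\mathcal{G}^e}\mathbf{1}^T (L^g)^T S_J^g W^g v_n^-, \qquad v_n^- = n_x^{-g}L^g v_x + n_y^{-g}L^g v_y .$$ Then the scheme is both conservative and constant preserving.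
   Context: Definitions. The scheme is \emph{constant preserving} if, whenever there are real constants $\beta,\gamma_x,\gamma_y$ such that on all elements $p=\beta\mathbf{1}$, $v_x=\gamma_x\mathbf{1}$, $v_y=\gamma_y\mathbf{1}$, the scheme gives $M_J\frac{dp}{dt}=M_J\frac{dv_x}{dt}=M_J\frac{dv_y}{dt}=0$ on all elements. The scheme is \emph{conservative} if every solution satisfies $$\sum_{e\in\mathcal{E}}\mathbf{1}^TM_J\frac{dp}{dt}=0,\qquad \sum_{e\in\mathcal{E}}\mathbf{1}^TM_J\frac{dv_x}{dt}=0,\qquad \sum_{e\in\mathcal{E}}\mathbf{1}^TM_J\frac{dv_y}{dt}=0 .$$ Model problem: the 2D acoustic wave equation $\partial_t p + \nabla\cdot v = 0$, $\partial_t v + \nabla p = 0$ on $\Omega\subset\mathbb{R}^2$, $v=(v_x,v_y)$, with periodic boundary conditions. Mesh. $\Omega$ is partitioned into a finite set $\mathcal{E}$ of non-overlapping elements, each the image of a reference element $\hat e$ with coordinates $(r,s)$. The mortar $\Gamma=\bigcup_e\partial e$ is partitioned into a finite set $\mathcal{G}$ of non-overlapping one-dimensional mortar elements, each the image of a reference interval $\hat g$. By periodicity (opposite boundary parts being identified) each mortar element is shared by two elements. $\mathcal{G}^e$ is the set of mortar elements connected to $e$. Unknowns. For each $e$ there is a finite-dimensional space $V_h^e$ of functions on $\hat e$ (a Galerkin difference space or a polynomial space) with a basis $\{\phi_k\}$ for which the vector of ones $\mathbf{1}$ represents the constant function $1$; $p,v_x,v_y$ are the time-dependent coefficient vectors on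 $e$. All vectors and matrices depend on $e$ in general, although this is suppressed in the notation. Volume matrices. $W$ is the diagonal matrix of strictly positive quadrature weights on $\hat e$; $J$ is the diagonal matrix of values of the Jacobian determinant at the quadrature nodes; $L$ evaluates a function in $V_h^e$ (given by its coefficients) at the quadrature nodes; $D_r,D_s$ evaluate its $r$- and $s$-derivatives there; $r_x,s_x,r_y,s_y$ are diagonal matrices of (approximate) values of $\partial r/\partial x,\partial s/\partial x,\partial r/\partial y,\partial s/\partial y$ at the quadrature nodes. Then $M_J=L^TWJL$ (assumed symmetric positive definite), $S_x=L^TWJ(r_xD_r+s_xD_s)$, $S_y=L^TWJ(r_yD_r+s_yD_s)$. Element surface terms. The coordinate functions of the element are $x,y\in V_h^e$; with $(\hat n_r,\hat n_s)$ the outward unit normal of $\partial\hat e$ and integration over $\partial\hat e$ with respect to arc length, the element surface Jacobian $S_J$ and outward normal $(n_x,n_y)$ calculated from $x,y$ are given by $S_Jn_x=\hat n_r\,\partial y/\partial s-\hat n_s\,\partial y/\partial r$ and $S_Jn_y=-\hat n_r\,\partial x/\partial s+\hat n_s\,\partial x/\partial r$. Mortar matrices. For each $g\in\mathcal{G}$ a quadrature rule on $\hat g$ with positive weights is fixed; $W^g$ is the diagonal matrix of its weights and $S_J^g$ the diagonal matrix of values of the mortar surface Jacobian determinant at its nodes; both are the same for the two elements sharing $g$. $L^g$ (depending on the element $e$) maps the coefficient vector of a function in $V_h^e$ to the values of its trace at the quadrature nodes of $g$. $n_x^{-g},n_y^{-g}$ are the diagonal matrices of components, at the mortar quadrature nodes,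 of the unit normal to $g$ outward with respect to $e$; for the two elements sharing $g$ these are equal in magnitude and opposite in sign. Fluxes. As seen from $e$ on $g\in\mathcal{G}^e$: $p^-=L^gp$ and $v_n^-=n_x^{-g}L^gv_x+n_y^{-g}L^gv_y$; $p^+$ and $v_n^+$ are the values at the same nodes computed from the other element connected to $g$ (with its own interpolation matrix), where $v_n^+$ uses the same normal $n^{-g}$ (outward to $e$). Componentwise, $$p^*=\tfrac12(p^++p^-)-\tfrac{\alpha}{2}(v_n^+-v_n^-),\qquad v_n^*=\tfrac12(v_n^++v_n^-)-\tfrac{\alpha}{2}(p^+-p^-),$$ for a constant $\alpha\ge0$. *)

theory Defs
  imports "Jordan_Normal_Form.Matrix" "HOL-Analysis.Analysis"
begin

unbundle no vec_syntax
hide_type (open) Finite_Cartesian_Product.vec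
hide_const (open) Finite_Cartesian_Product.vec Finite_Cartesian_Product.mat

text \<open>
  \<open>'e\<close> names elements, \<open>'g\<close> names mortar elements. The reference element, the space, its dimension
  and all quadrature rules may differ from element to element (mortar to mortar); the reference
  interval is \<open>{ghat_l..ghat_r}\<close>.

  The mesh geometry (\<open>emap\<close>, \<open>gmap\<close>) is the true one. The metric quantities (\<open>jac\<close>, \<open>r_x\<close>, \dots,
  \<open>s_jac\<close>, \<open>n_x\<close>, \<open>n_y\<close>) are the numerical values stored at the quadrature nodes, and \<open>xcoef\<close>, \<open>ycoef\<close>
  are the coefficients of the coordinate functions in the discrete space. None of these is
  required to be exact for \<open>emap\<close>, \<open>gmap\<close>.
\<close>

record ('e, 'g) discretization =
  Omega :: "(real \<times> real) set"
  elements :: "'e set"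
  mortars :: "'g set"
  mortars_of :: "'e \<Rightarrow> 'g set"
  ref_elem :: "'e \<Rightarrow> (real \<times> real) set"
  ref_bdry :: "'e \<Rightarrow> real \<Rightarrow> real \<times> real"
  emap :: "'e \<Rightarrow> real \<times> real \<Rightarrow> real \<times> real"
  ghat_l :: real
  ghat_r :: real
  gmap :: "'e \<Rightarrow> 'g \<Rightarrow> real \<Rightarrow> real \<times> real"
  ndof :: "'e \<Rightarrow> nat"
  basis :: "'e \<Rightarrow> nat \<Rightarrow> real \<times> real \<Rightarrow> real"
  xcoef :: "'e \<Rightarrow> real Matrix.vec"
  ycoef :: "'e \<Rightarrow> real Matrix.vec"
  nvol :: "'e \<Rightarrow> nat"
  vnode :: "'e \<Rightarrow> nat \<Rightarrow> real \<times> real"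
  vweight :: "'e \<Rightarrow> nat \<Rightarrow> real"
  jac :: "'e \<Rightarrow> nat \<Rightarrow> real"
  r_x :: "'e \<Rightarrow> nat \<Rightarrow> real"
  s_x :: "'e \<Rightarrow> nat \<Rightarrow> real"
  r_y :: "'e \<Rightarrow> nat \<Rightarrow> real"
  s_y :: "'e \<Rightarrow> nat \<Rightarrow> real"
  nmort :: "'g \<Rightarrow> nat"
  mnode :: "'g \<Rightarrow> nat \<Rightarrow> real"
  mweight :: "'g \<Rightarrow> nat \<Rightarrow> real"
  s_jac :: "'g \<Rightarrow> nat \<Rightarrow> real"
  n_x :: "'e \<Rightarrow> 'g \<Rightarrow> nat \<Rightarrow> real"
  n_y :: "'e \<Rightarrow> 'g \<Rightarrow> nat \<Rightarrow> real"
  alpha :: real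

definition element :: "('e, 'g) discretization \<Rightarrow> 'e \<Rightarrow> (real \<times> real) set" where
  "element D e = emap D e ` ref_elem D e"

text \<open>
  \<open>gmap D e g\<close> parametrizes the copy of the mortar element \<open>g\<close> lying on the boundary of \<open>e\<close>. The copies
  seen from the two elements sharing \<open>g\<close> differ by a translation \<open>c\<close>: it is \<open>0\<close> in the interior, and
  \<open>c \<noteq> 0\<close> is the periodic identification of two opposite parts of the boundary of \<open>Omega\<close>.
\<close>

definition periodic_mesh :: "('e, 'g) discretization \<Rightarrow> bool" where
  "periodic_mesh D \<longleftrightarrow>
     finite (elements D) \<and> finite (mortars D) \<and> ghat_l D < ghat_r D \<and>
     (\<forall>e\<in>elements D. continuous_on (ref_elem D e) (emap D e) \<and> inj_on (emap D e) (ref_elem D e)) \<and>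
     closure (Omega D) = (\<Union>e\<in>elements D. element D e) \<and>
     (\<forall>e\<in>elements D. \<forall>e'\<in>elements D. e \<noteq> e' \<longrightarrow>
        interior (element D e) \<inter> interior (element D e') = {}) \<and>
     (\<forall>e\<in>elements D. mortars_of D e \<subseteq> mortars D \<and>
        frontier (element D e) = (\<Union>g\<in>mortars_of D e. gmap D e g ` {ghat_l D..ghat_r D}) \<and>
        (\<forall>g\<in>mortars_of D e. continuous_on {ghat_l D..ghat_r D} (gmap D e g) \<and>
           inj_on (gmap D e g) {ghat_l D..ghat_r D})) \<and>
     (\<forall>e\<in>elements D. \<forall>e'\<in>elements D. \<forall>g\<in>mortars_of D e. \<forall>g'\<in>mortars_of D e'. g \<noteq> g' \<longrightarrow>
        gmap D e g ` {ghat_l D<..<ghat_r D} \<inter> gmap D e' g' ` {ghat_l D<..<ghat_r D} = {}) \<and>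
     (\<forall>g\<in>mortars D. card {e\<in>elements D. g \<in> mortars_of D e} = 2) \<and>
     (\<forall>e\<in>elements D. \<forall>e'\<in>elements D. \<forall>g\<in>mortars_of D e \<inter> mortars_of D e'. e \<noteq> e' \<longrightarrow>
        (\<exists>c. (\<forall>\<xi>\<in>{ghat_l D..ghat_r D}. gmap D e g \<xi> = gmap D e' g \<xi> + c) \<and>
             (c \<noteq> 0 \<longrightarrow> gmap D e g ` {ghat_l D..ghat_r D} \<subseteq> frontier (Omega D))))"

definition other :: "('e, 'g) discretization \<Rightarrow> 'e \<Rightarrow> 'g \<Rightarrow> 'e" where
  "other D e g = (THE e'. e' \<in> elements D \<and> g \<in> mortars_of D e' \<and> e' \<noteq> e)"

text \<open>Convexity makes derivatives within the reference element unique, also at its boundary.\<close>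

definition reference_element :: "(real \<times> real) set \<Rightarrow> (real \<Rightarrow> real \<times> real) \<Rightarrow> bool" where
  "reference_element K \<gamma> \<longleftrightarrow>
     compact K \<and> convex K \<and> interior K \<noteq> {} \<and>
     simple_path \<gamma> \<and> pathfinish \<gamma> = pathstart \<gamma> \<and> \<gamma> piecewise_C1_differentiable_on {0..1} \<and>
     path_image \<gamma> = frontier K"

definition pd_r :: "(real \<times> real) set \<Rightarrow> (real \<times> real \<Rightarrow> real) \<Rightarrow> real \<times> real \<Rightarrow> real" where
  "pd_r K f z = frechet_derivative f (at z within K) (1, 0)"

definition pd_s :: "(real \<times> real) set \<Rightarrow> (real \<times> real \<Rightarrow> real) \<Rightarrow> real \<times> real \<Rightarrow> real" where
  "pd_s K f z = frechet_derivative f (at z within K) (0, 1)"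

text \<open>
  The unit vector spanning the normal cone of the convex set \<open>K\<close>. It is not unique at corners of
  \<open>K\<close>, which do not contribute to boundary integrals.
\<close>

definition outward_unit_normal :: "(real \<times> real) set \<Rightarrow> real \<times> real \<Rightarrow> real \<times> real" where
  "outward_unit_normal K z = (THE n. norm n = 1 \<and> (\<forall>w\<in>K. inner n (w - z) \<le> 0))"

definition func :: "('e, 'g) discretization \<Rightarrow> 'e \<Rightarrow> real Matrix.vec \<Rightarrow> real \<times> real \<Rightarrow> real" where
  "func D e u z = (\<Sum>k<ndof D e. u $ k * basis D e k z)"

text \<open>The products $S_J n_x$ and $S_J n_y$ of the element surface Jacobian and normal.\<close>

definition surf_nx :: "('e, 'g) discretization \<Rightarrow> 'e \<Rightarrow> real \<times> real \<Rightarrow> real" where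
  "surf_nx D e z =
     (let (nr, ns) = outward_unit_normal (ref_elem D e) z; y = func D e (ycoef D e)
      in nr * pd_s (ref_elem D e) y z - ns * pd_r (ref_elem D e) y z)"

definition surf_ny :: "('e, 'g) discretization \<Rightarrow> 'e \<Rightarrow> real \<times> real \<Rightarrow> real" where
  "surf_ny D e z =
     (let (nr, ns) = outward_unit_normal (ref_elem D e) z; x = func D e (xcoef D e)
      in - nr * pd_s (ref_elem D e) x z + ns * pd_r (ref_elem D e) x z)"

definition arc_integrand :: "(real \<Rightarrow> real \<times> real) \<Rightarrow> (real \<times> real \<Rightarrow> real) \<Rightarrow> real \<Rightarrow> real" where
  "arc_integrand \<gamma> f t = f (\<gamma> t) * norm (vector_derivative \<gamma> (at t))"

definition arc_integral :: "(real \<Rightarrow> real \<times> real) \<Rightarrow> (real \<times> real \<Rightarrow> real) \<Rightarrow> real" where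
  "arc_integral \<gamma> f = integral {0..1} (arc_integrand \<gamma> f)"

text \<open>
  Besides being a basis whose elements sum to one, the basis functions are regular enough for the
  scheme to be meaningful: they have traces, they have derivatives at the volume quadrature nodes
  and at all but finitely many boundary points, and the boundary integrals exist.
\<close>

definition discrete_space :: "('e, 'g) discretization \<Rightarrow> 'e \<Rightarrow> bool" where
  "discrete_space D e \<longleftrightarrow>
     (\<forall>c. (\<forall>z\<in>ref_elem D e. (\<Sum>k<ndof D e. c k * basis D e k z) = 0) \<longrightarrow> (\<forall>k<ndof D e. c k = 0)) \<and>
     (\<forall>z\<in>ref_elem D e. (\<Sum>k<ndof D e. basis D e k z) = 1) \<and>
     xcoef D e \<in> carrier_vec (ndof D e) \<and> ycoef D e \<in> carrier_vec (ndof D e) \<and>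
     (\<forall>k<ndof D e.
        continuous_on (ref_elem D e) (basis D e k) \<and>
        (\<forall>q<nvol D e. basis D e k differentiable (at (vnode D e q) within ref_elem D e)) \<and>
        finite {t\<in>{0..1}. \<not> basis D e k differentiable (at (ref_bdry D e t) within ref_elem D e)} \<and>
        arc_integrand (ref_bdry D e) (\<lambda>z. surf_nx D e z * basis D e k z) integrable_on {0..1} \<and>
        arc_integrand (ref_bdry D e) (\<lambda>z. surf_ny D e z * basis D e k z) integrable_on {0..1})"

definition quadrature :: "('e, 'g) discretization \<Rightarrow> bool" where
  "quadrature D \<longleftrightarrow>
     (\<forall>e\<in>elements D. \<forall>q<nvol D e. vnode D e q \<in> ref_elem D e \<and> vweight D e q > 0) \<and>
     (\<forall>g\<in>mortars D. \<forall>i<nmort D g. mnode D g i \<in> {ghat_l D..ghat_r D} \<and> mweight D g i > 0)"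

definition mortar_normals :: "('e, 'g) discretization \<Rightarrow> bool" where
  "mortar_normals D \<longleftrightarrow>
     (\<forall>e\<in>elements D. \<forall>g\<in>mortars_of D e. \<forall>i<nmort D g.
        (n_x D e g i)\<^sup>2 + (n_y D e g i)\<^sup>2 = 1 \<and>
        n_x D (other D e g) g i = - n_x D e g i \<and>
        n_y D (other D e g) g i = - n_y D e g i)"

definition ones :: "nat \<Rightarrow> real Matrix.vec" where
  "ones n = Matrix.vec n (\<lambda>_. 1)"

definition L :: "('e, 'g) discretization \<Rightarrow> 'e \<Rightarrow> real Matrix.mat" where
  "L D e = Matrix.mat (nvol D e) (ndof D e) (\<lambda>(q, k). basis D e k (vnode D e q))"

definition D_r :: "('e, 'g) discretization \<Rightarrow> 'e \<Rightarrow> real Matrix.mat" where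
  "D_r D e = Matrix.mat (nvol D e) (ndof D e)
     (\<lambda>(q, k). pd_r (ref_elem D e) (basis D e k) (vnode D e q))"

definition D_s :: "('e, 'g) discretization \<Rightarrow> 'e \<Rightarrow> real Matrix.mat" where
  "D_s D e = Matrix.mat (nvol D e) (ndof D e)
     (\<lambda>(q, k). pd_s (ref_elem D e) (basis D e k) (vnode D e q))"

definition vol_diag ::
    "('e, 'g) discretization \<Rightarrow> 'e \<Rightarrow> ('e \<Rightarrow> nat \<Rightarrow> real) \<Rightarrow> real Matrix.mat" where
  "vol_diag D e a = mat_diag (nvol D e) (a e)"

definition M_J :: "('e, 'g) discretization \<Rightarrow> 'e \<Rightarrow> real Matrix.mat" where
  "M_J D e = transpose_mat (L D e) * vol_diag D e (vweight D) * vol_diag D e (jac D) * L D e"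

definition S_x :: "('e, 'g) discretization \<Rightarrow> 'e \<Rightarrow> real Matrix.mat" where
  "S_x D e = transpose_mat (L D e) * vol_diag D e (vweight D) * vol_diag D e (jac D) *
     (vol_diag D e (r_x D) * D_r D e + vol_diag D e (s_x D) * D_s D e)"

definition S_y :: "('e, 'g) discretization \<Rightarrow> 'e \<Rightarrow> real Matrix.mat" where
  "S_y D e = transpose_mat (L D e) * vol_diag D e (vweight D) * vol_diag D e (jac D) *
     (vol_diag D e (r_y D) * D_r D e + vol_diag D e (s_y D) * D_s D e)"

definition sym_pos_def :: "nat \<Rightarrow> real Matrix.mat \<Rightarrow> bool" where
  "sym_pos_def n A \<longleftrightarrow> A \<in> carrier_mat n n \<and> transpose_mat A = A \<and>
     (\<forall>u\<in>carrier_vec n. u \<noteq> 0\<^sub>v n \<longrightarrow> u \<bullet> (A *\<^sub>v u) > 0)"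

text \<open>The point of the reference element of \<open>e\<close> that is mapped to the \<open>i\<close>-th quadrature node of \<open>g\<close>.\<close>

definition trace_node :: "('e, 'g) discretization \<Rightarrow> 'e \<Rightarrow> 'g \<Rightarrow> nat \<Rightarrow> real \<times> real" where
  "trace_node D e g i = inv_into (ref_elem D e) (emap D e) (gmap D e g (mnode D g i))"

definition Lg :: "('e, 'g) discretization \<Rightarrow> 'e \<Rightarrow> 'g \<Rightarrow> real Matrix.mat" where
  "Lg D e g = Matrix.mat (nmort D g) (ndof D e) (\<lambda>(i, k). basis D e k (trace_node D e g i))"

definition Wg :: "('e, 'g) discretization \<Rightarrow> 'g \<Rightarrow> real Matrix.mat" where
  "Wg D g = mat_diag (nmort D g) (mweight D g)"

definition SJg :: "('e, 'g) discretization \<Rightarrow> 'g \<Rightarrow> real Matrix.mat" where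
  "SJg D g = mat_diag (nmort D g) (s_jac D g)"

definition Nxg :: "('e, 'g) discretization \<Rightarrow> 'e \<Rightarrow> 'g \<Rightarrow> real Matrix.mat" where
  "Nxg D e g = mat_diag (nmort D g) (n_x D e g)"

definition Nyg :: "('e, 'g) discretization \<Rightarrow> 'e \<Rightarrow> 'g \<Rightarrow> real Matrix.mat" where
  "Nyg D e g = mat_diag (nmort D g) (n_y D e g)"

definition valid_discretization :: "('e, 'g) discretization \<Rightarrow> bool" where
  "valid_discretization D \<longleftrightarrow>
     periodic_mesh D \<and> quadrature D \<and> mortar_normals D \<and> alpha D \<ge> 0 \<and>
     (\<forall>e\<in>elements D. reference_element (ref_elem D e) (ref_bdry D e) \<and> discrete_space D e \<and>
        sym_pos_def (ndof D e) (M_J D e))"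

definition p_minus ::
    "('e, 'g) discretization \<Rightarrow> ('e \<Rightarrow> real Matrix.vec) \<Rightarrow> 'e \<Rightarrow> 'g \<Rightarrow> real Matrix.vec" where
  "p_minus D p e g = Lg D e g *\<^sub>v p e"

definition p_plus ::
    "('e, 'g) discretization \<Rightarrow> ('e \<Rightarrow> real Matrix.vec) \<Rightarrow> 'e \<Rightarrow> 'g \<Rightarrow> real Matrix.vec" where
  "p_plus D p e g = Lg D (other D e g) g *\<^sub>v p (other D e g)"

definition vn_minus ::
    "('e, 'g) discretization \<Rightarrow> ('e \<Rightarrow> real Matrix.vec) \<Rightarrow> ('e \<Rightarrow> real Matrix.vec) \<Rightarrow>
     'e \<Rightarrow> 'g \<Rightarrow> real Matrix.vec" where
  "vn_minus D vx vy e g =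
     Nxg D e g *\<^sub>v (Lg D e g *\<^sub>v vx e) + Nyg D e g *\<^sub>v (Lg D e g *\<^sub>v vy e)"

definition vn_plus ::
    "('e, 'g) discretization \<Rightarrow> ('e \<Rightarrow> real Matrix.vec) \<Rightarrow> ('e \<Rightarrow> real Matrix.vec) \<Rightarrow>
     'e \<Rightarrow> 'g \<Rightarrow> real Matrix.vec" where
  "vn_plus D vx vy e g =
     Nxg D e g *\<^sub>v (Lg D (other D e g) g *\<^sub>v vx (other D e g)) +
     Nyg D e g *\<^sub>v (Lg D (other D e g) g *\<^sub>v vy (other D e g))"

definition p_star ::
    "('e, 'g) discretization \<Rightarrow> ('e \<Rightarrow> real Matrix.vec) \<Rightarrow> ('e \<Rightarrow> real Matrix.vec) \<Rightarrow>
     ('e \<Rightarrow> real Matrix.vec) \<Rightarrow> 'e \<Rightarrow> 'g \<Rightarrow> real Matrix.vec" where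
  "p_star D p vx vy e g =
     (1/2) \<cdot>\<^sub>v (p_plus D p e g + p_minus D p e g) -
     (alpha D / 2) \<cdot>\<^sub>v (vn_plus D vx vy e g - vn_minus D vx vy e g)"

definition vn_star ::
    "('e, 'g) discretization \<Rightarrow> ('e \<Rightarrow> real Matrix.vec) \<Rightarrow> ('e \<Rightarrow> real Matrix.vec) \<Rightarrow>
     ('e \<Rightarrow> real Matrix.vec) \<Rightarrow> 'e \<Rightarrow> 'g \<Rightarrow> real Matrix.vec" where
  "vn_star D p vx vy e g =
     (1/2) \<cdot>\<^sub>v (vn_plus D vx vy e g + vn_minus D vx vy e g) -
     (alpha D / 2) \<cdot>\<^sub>v (p_plus D p e g - p_minus D p e g)"

definition mortar_sum ::
    "('e, 'g) discretization \<Rightarrow> 'e \<Rightarrow> ('g \<Rightarrow> real Matrix.vec) \<Rightarrow> real Matrix.vec" where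
  "mortar_sum D e f = Matrix.vec (ndof D e) (\<lambda>k. \<Sum>g\<in>mortars_of D e. f g $ k)"

text \<open>The scheme at one instant: \<open>p, vx, vy\<close> is the state, \<open>dp, dvx, dvy\<close> its time derivative.\<close>

definition scheme ::
    "('e, 'g) discretization \<Rightarrow>
     ('e \<Rightarrow> real Matrix.vec) \<Rightarrow> ('e \<Rightarrow> real Matrix.vec) \<Rightarrow> ('e \<Rightarrow> real Matrix.vec) \<Rightarrow>
     ('e \<Rightarrow> real Matrix.vec) \<Rightarrow> ('e \<Rightarrow> real Matrix.vec) \<Rightarrow> ('e \<Rightarrow> real Matrix.vec) \<Rightarrow> bool" where
  "scheme D p vx vy dp dvx dvy \<longleftrightarrow>
     (\<forall>e\<in>elements D.
        p e \<in> carrier_vec (ndof D e) \<and> vx e \<in> carrier_vec (ndof D e) \<and>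
        vy e \<in> carrier_vec (ndof D e) \<and>
        dp e \<in> carrier_vec (ndof D e) \<and> dvx e \<in> carrier_vec (ndof D e) \<and>
        dvy e \<in> carrier_vec (ndof D e) \<and>
        M_J D e *\<^sub>v dp e + S_x D e *\<^sub>v vx e + S_y D e *\<^sub>v vy e =
          - mortar_sum D e (\<lambda>g. transpose_mat (Lg D e g) * SJg D g * Wg D g *\<^sub>v
              (vn_star D p vx vy e g - vn_minus D vx vy e g)) \<and>
        M_J D e *\<^sub>v dvx e - transpose_mat (S_x D e) *\<^sub>v p e =
          - mortar_sum D e (\<lambda>g. transpose_mat (Lg D e g) * Nxg D e g * SJg D g * Wg D g *\<^sub>v
              p_star D p vx vy e g) \<and>
        M_J D e *\<^sub>v dvy e - transpose_mat (S_y D e) *\<^sub>v p e =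
          - mortar_sum D e (\<lambda>g. transpose_mat (Lg D e g) * Nyg D e g * SJg D g * Wg D g *\<^sub>v
              p_star D p vx vy e g))"

text \<open>
  The type of vectors of unspecified dimension is not a normed space, so time derivatives are taken
  componentwise; at end points of the time interval \<open>T\<close> they are one-sided.
\<close>

definition ddt :: "real set \<Rightarrow> (real \<Rightarrow> real Matrix.vec) \<Rightarrow> real \<Rightarrow> real Matrix.vec" where
  "ddt T u t = Matrix.vec (dim_vec (u t)) (\<lambda>k. vector_derivative (\<lambda>\<tau>. u \<tau> $ k) (at t within T))"

definition solution ::
    "('e, 'g) discretization \<Rightarrow> real set \<Rightarrow> ('e \<Rightarrow> real \<Rightarrow> real Matrix.vec) \<Rightarrow>
     ('e \<Rightarrow> real \<Rightarrow> real Matrix.vec) \<Rightarrow> ('e \<Rightarrow> real \<Rightarrow> real Matrix.vec) \<Rightarrow> bool" where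
  "solution D T p vx vy \<longleftrightarrow>
     (\<forall>t\<in>T.
        (\<forall>e\<in>elements D. \<forall>k<ndof D e.
           (\<lambda>\<tau>. p e \<tau> $ k) differentiable (at t within T) \<and>
           (\<lambda>\<tau>. vx e \<tau> $ k) differentiable (at t within T) \<and>
           (\<lambda>\<tau>. vy e \<tau> $ k) differentiable (at t within T)) \<and>
        scheme D (\<lambda>e. p e t) (\<lambda>e. vx e t) (\<lambda>e. vy e t)
          (\<lambda>e. ddt T (p e) t) (\<lambda>e. ddt T (vx e) t) (\<lambda>e. ddt T (vy e) t))"

definition conservative :: "('e, 'g) discretization \<Rightarrow> bool" where
  "conservative D \<longleftrightarrow>
     (\<forall>T p vx vy. is_interval T \<and> interior T \<noteq> {} \<and> solution D T p vx vy \<longrightarrow>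
        (\<forall>t\<in>T.
           (\<Sum>e\<in>elements D. ones (ndof D e) \<bullet> (M_J D e *\<^sub>v ddt T (p e) t)) = 0 \<and>
           (\<Sum>e\<in>elements D. ones (ndof D e) \<bullet> (M_J D e *\<^sub>v ddt T (vx e) t)) = 0 \<and>
           (\<Sum>e\<in>elements D. ones (ndof D e) \<bullet> (M_J D e *\<^sub>v ddt T (vy e) t)) = 0))"

definition constant_preserving :: "('e, 'g) discretization \<Rightarrow> bool" where
  "constant_preserving D \<longleftrightarrow>
     (\<forall>\<beta> \<gamma>x \<gamma>y p vx vy dp dvx dvy.
        (\<forall>e\<in>elements D. p e = \<beta> \<cdot>\<^sub>v ones (ndof D e) \<and> vx e = \<gamma>x \<cdot>\<^sub>v ones (ndof D e) \<and>
           vy e = \<gamma>y \<cdot>\<^sub>v ones (ndof D e)) \<and>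
        scheme D p vx vy dp dvx dvy \<longrightarrow>
        (\<forall>e\<in>elements D. M_J D e *\<^sub>v dp e = 0\<^sub>v (ndof D e) \<and>
           M_J D e *\<^sub>v dvx e = 0\<^sub>v (ndof D e) \<and> M_J D e *\<^sub>v dvy e = 0\<^sub>v (ndof D e)))"

definition surface_flux ::
    "('e, 'g) discretization \<Rightarrow> 'e \<Rightarrow> real Matrix.vec \<Rightarrow> real Matrix.vec \<Rightarrow> real" where
  "surface_flux D e u w =
     arc_integral (ref_bdry D e)
       (\<lambda>z. surf_nx D e z * func D e u z + surf_ny D e z * func D e w z)"

definition discrete_divergence_theorem :: "('e, 'g) discretization \<Rightarrow> 'e \<Rightarrow> bool" where
  "discrete_divergence_theorem D e \<longleftrightarrow>
     (\<forall>u\<in>carrier_vec (ndof D e). \<forall>w\<in>carrier_vec (ndof D e).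
        ones (ndof D e) \<bullet> (S_x D e *\<^sub>v u) + ones (ndof D e) \<bullet> (S_y D e *\<^sub>v w) =
          surface_flux D e u w)"

definition surface_consistency :: "('e, 'g) discretization \<Rightarrow> 'e \<Rightarrow> bool" where
  "surface_consistency D e \<longleftrightarrow>
     (\<forall>u\<in>carrier_vec (ndof D e). \<forall>w\<in>carrier_vec (ndof D e).
        surface_flux D e u w =
          (\<Sum>g\<in>mortars_of D e. ones (ndof D e) \<bullet>
             (transpose_mat (Lg D e g) * SJg D g * Wg D g *\<^sub>v vn_minus D (\<lambda>_. u) (\<lambda>_. w) e g)))"

end

theory Submission
  imports Defs
begin

(* The dot denotes the product of vectors of variable dimension only. *)
unbundle no inner_syntax

text \<open>
  The proof tests the scheme against a vector \<open>u\<close> on each element; conservation is the choice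
  \<open>u = 1\<close>, while constant preservation needs every \<open>u\<close>. Three facts carry it.

  The operators annihilate constants: \<open>S\<^sub>x 1 = S\<^sub>y 1 = 0\<close>, because the basis functions sum to one on
  the reference element, so that their derivatives there sum to zero (\<open>S_ones\<close>). Likewise \<open>L\<^sup>g 1 = 1\<close>.

  Numerical fluxes are single valued: exchanging the two elements at a mortar element reverses the
  normal, hence changes the sign of \<open>v\<^sub>n\<^sup>*\<close> and of \<open>n p\<^sup>*\<close> (\<open>star_antisym\<close>). Quantities that change
  sign in this way cancel in pairs when summed over all elements and their mortar elements
  (\<open>sum_mortars_cancel\<close>).

  The two hypotheses combine to a summation-by-parts rule: \<open>1\<^sup>T S\<^sub>x v\<^sub>x + 1\<^sup>T S\<^sub>y v\<^sub>y\<close> equals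
  the quadrature sum of \<open>v\<^sub>n\<^sup>-\<close> over the mortar elements (\<open>divergence_eq_mortar_flux\<close>).

  Conservation: for the pressure, summation by parts cancels the volume terms against the
  \<open>v\<^sub>n\<^sup>-\<close> part of the surface terms and leaves the sum of the fluxes \<open>v\<^sub>n\<^sup>*\<close>; for the velocity,
  the volume terms are \<open>(S\<^sub>x 1)\<^sup>T p = 0\<close> and the sum of the fluxes \<open>n p\<^sup>*\<close> is left. Both sums cancel.

  Constant preservation: for constant states \<open>v\<^sub>n\<^sup>* = v\<^sub>n\<^sup>-\<close> and \<open>p\<^sup>* = \<beta>\<close>. The pressure equation
  reduces to \<open>S\<^sub>x 1 = S\<^sub>y 1 = 0\<close>. The velocity equations tested with \<open>u\<close> contain \<open>\<beta>\<close> times the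
  difference of the two sides of the summation-by-parts rule for the velocities \<open>(u, 0)\<close> and \<open>(0, u)\<close>.
\<close>

section \<open>Derivatives relative to a convex body\<close>

text \<open>
  Directions in which a corner of \<open>K\<close> can be left within \<open>K\<close> need not contain the coordinate
  directions. But \<open>A\<close> vanishes on all \<open>w - z\<close> with \<open>w\<close> in \<open>K\<close>, since the segment from \<open>z\<close> to \<open>w\<close>
  lies in \<open>K\<close>, and these vectors span because \<open>K\<close> has interior points.
\<close>

lemma has_derivative_constant_within_convex_eq_0:
  fixes f :: "'a::real_normed_vector \<Rightarrow> 'b::real_normed_vector"
  assumes K: "convex K" "interior K \<noteq> {}" and z: "z \<in> K"
    and f: "(f has_derivative A) (at z within K)" and const: "\<And>w. w \<in> K \<Longrightarrow> f w = c"
  shows "A h = 0"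
proof -
  have lin: "linear A"
    using f has_derivative_linear by blast
  have A0: "A (w - z) = 0" if w: "w \<in> K" for w
  proof -
    define \<phi> where "\<phi> t = z + t *\<^sub>R (w - z)" for t :: real
    have \<phi>: "(\<phi> has_derivative (\<lambda>t. t *\<^sub>R (w - z))) (at 0 within {0..1})"
      unfolding \<phi>_def by (auto intro!: derivative_eq_intros)
    have sub: "\<phi> ` {0..1} \<subseteq> K"
    proof safe
      fix t :: real assume t: "t \<in> {0..1}"
      have "\<phi> t = (1 - t) *\<^sub>R z + t *\<^sub>R w"
        by (simp add: \<phi>_def algebra_simps)
      then show "\<phi> t \<in> K"
        using convexD[OF K(1) z w, of "1 - t" t] t by simp
    qed
    have "(f has_derivative A) (at (\<phi> 0) within \<phi> ` {0..1})"
      using has_derivative_subset[OF f sub] by (simp add: \<phi>_def)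
    then have "(f \<circ> \<phi> has_derivative A \<circ> (\<lambda>t. t *\<^sub>R (w - z))) (at 0 within {0..1})"
      using \<phi> by (rule diff_chain_within[rotated])
    then have "(f \<circ> \<phi> has_vector_derivative A (w - z)) (at 0 within {0..1})"
      by (simp add: has_vector_derivative_def o_def linear_scale[OF lin])
    moreover have "(f \<circ> \<phi> has_vector_derivative 0) (at 0 within {0..1})"
      by (rule has_vector_derivative_transform[where f = "\<lambda>_. c"])
        (use const sub in \<open>auto simp: image_subset_iff\<close>)
    moreover have "at (0::real) within {0..1} \<noteq> bot"
      by (simp add: trivial_limit_within islimpt_Icc)
    ultimately show ?thesis
      using vector_derivative_unique_within by blast
  qed
  obtain b \<epsilon> where b: "\<epsilon> > 0" "ball b \<epsilon> \<subseteq> K"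
    using K(2) by (meson ex_in_conv mem_interior)
  \<comment> \<open>adding \<open>1\<close> keeps the denominator positive for \<open>h = 0\<close>\<close>
  define \<delta> where "\<delta> = \<epsilon> / (2 * (norm h + 1))"
  have \<delta>: "\<delta> > 0" "\<delta> * norm h < \<epsilon>"
  proof -
    have n: "norm h + 1 > 0" by (simp add: add_nonneg_pos)
    show "\<delta> > 0" using b n by (simp add: \<delta>_def)
    have "\<delta> * norm h \<le> \<delta> * (norm h + 1)" using \<open>\<delta> > 0\<close> by simp
    also have "\<dots> = \<epsilon> / 2" using n by (simp add: \<delta>_def field_simps)
    finally show "\<delta> * norm h < \<epsilon>" using b by simp
  qed
  have "b \<in> K" "b + \<delta> *\<^sub>R h \<in> K"
    using b \<delta> by (auto simp: dist_norm intro!: subsetD[OF b(2)])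
  then have "A (b + \<delta> *\<^sub>R h - z) - A (b - z) = 0"
    by (simp add: A0)
  then have "A (\<delta> *\<^sub>R h) = 0"
    by (simp add: linear_diff[OF lin, symmetric])
  then show ?thesis
    using \<delta> by (simp add: linear_scale[OF lin])
qed

lemma sum_frechet_derivative_eq_0:
  fixes b :: "nat \<Rightarrow> 'a::real_normed_vector \<Rightarrow> real"
  assumes "convex K" "interior K \<noteq> {}" "z \<in> K"
    and "\<And>k. k < n \<Longrightarrow> b k differentiable (at z within K)"
    and "\<And>w. w \<in> K \<Longrightarrow> (\<Sum>k<n. b k w) = c"
  shows "(\<Sum>k<n. frechet_derivative (b k) (at z within K) h) = 0"
proof -
  have "((\<lambda>w. \<Sum>k<n. b k w) has_derivative
      (\<lambda>h. \<Sum>k<n. frechet_derivative (b k) (at z within K) h)) (at z within K)"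
    by (rule has_derivative_sum) (use assms(4) in \<open>auto simp: frechet_derivative_works\<close>)
  then show ?thesis
    using has_derivative_constant_within_convex_eq_0 assms(1-3,5) by blast
qed

section \<open>Matrices applied to constants\<close>

lemma ones_carrier [simp]: "ones n \<in> carrier_vec n"
  by (simp add: ones_def)

lemma mult_mat_ones:
  assumes "A \<in> carrier_mat m n" and "i < m"
  shows "(A *\<^sub>v ones n) $ i = (\<Sum>k<n. A $$ (i, k))"
  using assms by (auto simp: ones_def scalar_prod_def lessThan_atLeast0 intro!: sum.cong)

lemma vol_diag_carrier [simp]: "vol_diag D e a \<in> carrier_mat (nvol D e) (nvol D e)"
  by (simp add: vol_diag_def)

lemma L_carrier [simp]: "L D e \<in> carrier_mat (nvol D e) (ndof D e)"
  by (simp add: L_def)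

lemma D_carrier [simp]:
  "D_r D e \<in> carrier_mat (nvol D e) (ndof D e)" "D_s D e \<in> carrier_mat (nvol D e) (ndof D e)"
  by (simp_all add: D_r_def D_s_def)

lemma M_J_carrier [simp]: "M_J D e \<in> carrier_mat (ndof D e) (ndof D e)"
  unfolding M_J_def by (intro mult_carrier_mat[of _ _ "nvol D e"] transpose_carrier_mat; simp)

lemma S_carrier [simp]:
  "S_x D e \<in> carrier_mat (ndof D e) (ndof D e)" "S_y D e \<in> carrier_mat (ndof D e) (ndof D e)"
  unfolding S_x_def S_y_def
  by (intro mult_carrier_mat[of _ _ "nvol D e"] add_carrier_mat transpose_carrier_mat; simp)+

lemma Lg_carrier [simp]: "Lg D e g \<in> carrier_mat (nmort D g) (ndof D e)"
  by (simp add: Lg_def)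

lemma D_ones:
  assumes "valid_discretization D" "e \<in> elements D"
  shows "D_r D e *\<^sub>v ones (ndof D e) = 0\<^sub>v (nvol D e)" "D_s D e *\<^sub>v ones (ndof D e) = 0\<^sub>v (nvol D e)"
proof -
  have K: "convex (ref_elem D e)" "interior (ref_elem D e) \<noteq> {}"
    and q: "\<And>q. q < nvol D e \<Longrightarrow> vnode D e q \<in> ref_elem D e"
    and b: "\<And>k q. \<lbrakk>k < ndof D e; q < nvol D e\<rbrakk> \<Longrightarrow>
              basis D e k differentiable (at (vnode D e q) within ref_elem D e)"
      "\<And>z. z \<in> ref_elem D e \<Longrightarrow> (\<Sum>k<ndof D e. basis D e k z) = 1"
    using assms
    by (auto simp: valid_discretization_def reference_element_def quadrature_def discrete_space_def)
  have zero: "(\<Sum>k<ndof D e.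
      frechet_derivative (basis D e k) (at (vnode D e q) within ref_elem D e) h) = 0"
    if "q < nvol D e" for q h
    by (rule sum_frechet_derivative_eq_0[OF K q[OF that]]) (use b that in auto)
  show "D_r D e *\<^sub>v ones (ndof D e) = 0\<^sub>v (nvol D e)"
  proof (rule eq_vecI)
    fix q assume "q < dim_vec (0\<^sub>v (nvol D e) :: real Matrix.vec)"
    then have q: "q < nvol D e" by simp
    show "(D_r D e *\<^sub>v ones (ndof D e)) $ q = 0\<^sub>v (nvol D e) $ q"
      unfolding mult_mat_ones[OF D_carrier(1) q] using q by (simp add: D_r_def pd_r_def zero)
  qed (simp add: D_r_def)
  show "D_s D e *\<^sub>v ones (ndof D e) = 0\<^sub>v (nvol D e)"
  proof (rule eq_vecI)
    fix q assume "q < dim_vec (0\<^sub>v (nvol D e) :: real Matrix.vec)"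
    then have q: "q < nvol D e" by simp
    show "(D_s D e *\<^sub>v ones (ndof D e)) $ q = 0\<^sub>v (nvol D e) $ q"
      unfolding mult_mat_ones[OF D_carrier(2) q] using q by (simp add: D_s_def pd_s_def zero)
  qed (simp add: D_s_def)
qed

lemma mult_mat_zero_vec: "A \<in> carrier_mat m n \<Longrightarrow> A *\<^sub>v 0\<^sub>v n = (0\<^sub>v m :: real Matrix.vec)"
  by (rule eq_vecI) auto

lemma S_ones:
  assumes "valid_discretization D" "e \<in> elements D"
  shows "S_x D e *\<^sub>v ones (ndof D e) = 0\<^sub>v (ndof D e)" "S_y D e *\<^sub>v ones (ndof D e) = 0\<^sub>v (ndof D e)"
proof -
  have "(transpose_mat (L D e) * vol_diag D e w * vol_diag D e j *
      (vol_diag D e a * D_r D e + vol_diag D e b * D_s D e)) *\<^sub>v ones (ndof D e) = 0\<^sub>v (ndof D e)"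
    (is "(?P * ?Q) *\<^sub>v _ = _") for w j a b
  proof -
    have P: "?P \<in> carrier_mat (ndof D e) (nvol D e)"
      by (intro mult_carrier_mat[of _ _ "nvol D e"] transpose_carrier_mat; simp)
    have c: "vol_diag D e a * D_r D e \<in> carrier_mat (nvol D e) (ndof D e)"
      "vol_diag D e b * D_s D e \<in> carrier_mat (nvol D e) (ndof D e)"
      by (rule mult_carrier_mat[of _ _ "nvol D e"]; simp)+
    have "?Q *\<^sub>v ones (ndof D e) = 0\<^sub>v (nvol D e)"
      by (simp add: add_mult_distrib_mat_vec[OF c] D_ones[OF assms]
          assoc_mult_mat_vec[OF vol_diag_carrier D_carrier(1)]
          assoc_mult_mat_vec[OF vol_diag_carrier D_carrier(2)]
          mult_mat_zero_vec[OF vol_diag_carrier])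
    then show ?thesis
      using assoc_mult_mat_vec[OF P _ ones_carrier, of ?Q] c mult_mat_zero_vec[OF P] by simp
  qed
  then show "S_x D e *\<^sub>v ones (ndof D e) = 0\<^sub>v (ndof D e)"
    "S_y D e *\<^sub>v ones (ndof D e) = 0\<^sub>v (ndof D e)"
    by (simp_all add: S_x_def S_y_def)
qed

lemma periodic_meshD:
  assumes "periodic_mesh D"
  shows "finite (elements D)" and "finite (mortars D)"
    and "\<forall>e\<in>elements D. continuous_on (ref_elem D e) (emap D e) \<and> inj_on (emap D e) (ref_elem D e)"
    and "\<forall>e\<in>elements D. mortars_of D e \<subseteq> mortars D \<and>
        frontier (element D e) = (\<Union>g\<in>mortars_of D e. gmap D e g ` {ghat_l D..ghat_r D}) \<and>
        (\<forall>g\<in>mortars_of D e. continuous_on {ghat_l D..ghat_r D} (gmap D e g) \<and>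
           inj_on (gmap D e g) {ghat_l D..ghat_r D})"
    and "\<forall>g\<in>mortars D. card {e\<in>elements D. g \<in> mortars_of D e} = 2"
  using assms unfolding periodic_mesh_def by - (elim conjE, assumption)+

text \<open>
  A continuous image of the compact reference element is closed, so its frontier, which contains
  the mortar nodes, belongs to the element itself.
\<close>

lemma trace_node_in_ref_elem:
  assumes "valid_discretization D" "e \<in> elements D" "g \<in> mortars_of D e" "i < nmort D g"
  shows "trace_node D e g i \<in> ref_elem D e"
proof -
  have m: "periodic_mesh D" and "compact (ref_elem D e)"
    using assms by (auto simp: valid_discretization_def reference_element_def)
  moreover have "continuous_on (ref_elem D e) (emap D e)"
    and fr: "frontier (element D e) = (\<Union>g\<in>mortars_of D e. gmap D e g ` {ghat_l D..ghat_r D})"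
    and g: "g \<in> mortars D"
    using periodic_meshD(3,4)[OF m] assms(2,3) by auto
  ultimately have "closed (element D e)"
    unfolding element_def using compact_continuous_image compact_imp_closed by blast
  then have "frontier (element D e) \<subseteq> element D e"
    by (simp add: frontier_subset_closed)
  moreover have "mnode D g i \<in> {ghat_l D..ghat_r D}"
    using assms g by (auto simp: valid_discretization_def quadrature_def)
  ultimately have "gmap D e g (mnode D g i) \<in> emap D e ` ref_elem D e"
    using fr assms(3) unfolding element_def by blast
  then show ?thesis
    unfolding trace_node_def by (rule inv_into_into)
qed

lemma Lg_ones:
  assumes "valid_discretization D" "e \<in> elements D" "g \<in> mortars_of D e"
  shows "Lg D e g *\<^sub>v ones (ndof D e) = ones (nmort D g)"
proof (rule eq_vecI)
  fix i assume "i < dim_vec (ones (nmort D g))"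
  then have i: "i < nmort D g" by (simp add: ones_def)
  have "discrete_space D e"
    using assms by (simp add: valid_discretization_def)
  then have "(\<Sum>k<ndof D e. basis D e k (trace_node D e g i)) = 1"
    using trace_node_in_ref_elem[OF assms i] by (simp add: discrete_space_def)
  then show "(Lg D e g *\<^sub>v ones (ndof D e)) $ i = ones (nmort D g) $ i"
    unfolding mult_mat_ones[OF Lg_carrier i] using i by (simp add: Lg_def ones_def)
qed (simp add: Lg_def ones_def)

section \<open>The scheme in weak form\<close>

lemma mat_diag_mult_vec_index:
  fixes x :: "real Matrix.vec"
  assumes "x \<in> carrier_vec m" "i < m"
  shows "(mat_diag m d *\<^sub>v x) $ i = d i * x $ i"
proof -
  have "(mat_diag m d *\<^sub>v x) $ i = (\<Sum>j\<in>{0..<m}. (if i = j then d j else 0) * x $ j)"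
    using assms by (auto simp: mat_diag_def scalar_prod_def intro!: sum.cong)
  also have "\<dots> = (\<Sum>j\<in>{0..<m}. if i = j then d j * x $ j else 0)"
    by (rule sum.cong) auto
  finally show ?thesis using assms by simp
qed

lemma scalar_prod_transpose_mult_diag:
  fixes A :: "real Matrix.mat"
  assumes A: "A \<in> carrier_mat m n" and u: "u \<in> carrier_vec n" and x: "x \<in> carrier_vec m"
  shows "u \<bullet> (transpose_mat A * mat_diag m d *\<^sub>v x) = (\<Sum>i<m. (A *\<^sub>v u) $ i * d i * x $ i)"
proof -
  have dx: "mat_diag m d *\<^sub>v x \<in> carrier_vec m"
    by (rule mult_mat_vec_carrier[OF _ x]) simp
  have "u \<bullet> (transpose_mat A * mat_diag m d *\<^sub>v x) = u \<bullet> (transpose_mat A *\<^sub>v (mat_diag m d *\<^sub>v x))"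
    using assoc_mult_mat_vec[of "transpose_mat A" n m "mat_diag m d" m x] A x by simp
  also have "\<dots> = (transpose_mat A *\<^sub>v (mat_diag m d *\<^sub>v x)) \<bullet> u"
    using A u dx by (intro comm_scalar_prod[of _ n]) (auto intro: mult_mat_vec_carrier)
  also have "\<dots> = (mat_diag m d *\<^sub>v x) \<bullet> (A *\<^sub>v u)"
    by (rule transpose_vec_mult_scalar[OF A u dx])
  also have "\<dots> = (\<Sum>i<m. (A *\<^sub>v u) $ i * d i * x $ i)"
    using A unfolding scalar_prod_def
    by (auto simp: mat_diag_mult_vec_index[OF x] lessThan_atLeast0 mult_ac simp del: index_mult_mat_vec intro!: sum.cong)
  finally show ?thesis .
qed

text \<open>
  The surface integral over \<open>g\<close> of the trace of \<open>u\<close> times \<open>x\<close>, as computed by the mortar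
  quadrature. The nodal values \<open>x\<close> are a function, so that normals multiply them pointwise and
  all surface terms of the scheme have this one form.
\<close>

definition mortar_pairing ::
    "('e, 'g) discretization \<Rightarrow> 'e \<Rightarrow> 'g \<Rightarrow> real Matrix.vec \<Rightarrow> (nat \<Rightarrow> real) \<Rightarrow> real" where
  "mortar_pairing D e g u x =
     (\<Sum>i<nmort D g. (Lg D e g *\<^sub>v u) $ i * (s_jac D g i * mweight D g i) * x i)"

lemma scalar_prod_mortar_lift:
  assumes "u \<in> carrier_vec (ndof D e)" "x \<in> carrier_vec (nmort D g)"
  shows "u \<bullet> (transpose_mat (Lg D e g) * SJg D g * Wg D g *\<^sub>v x) =
      mortar_pairing D e g u (\<lambda>i. x $ i)"
    and "u \<bullet> (transpose_mat (Lg D e g) * Nxg D e g * SJg D g * Wg D g *\<^sub>v x) =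
      mortar_pairing D e g u (\<lambda>i. n_x D e g i * x $ i)"
    and "u \<bullet> (transpose_mat (Lg D e g) * Nyg D e g * SJg D g * Wg D g *\<^sub>v x) =
      mortar_pairing D e g u (\<lambda>i. n_y D e g i * x $ i)"
proof -
  let ?m = "nmort D g"
  have T: "transpose_mat (Lg D e g) \<in> carrier_mat (ndof D e) ?m" by simp
  have 2: "transpose_mat (Lg D e g) * mat_diag ?m a * mat_diag ?m b =
      transpose_mat (Lg D e g) * mat_diag ?m (\<lambda>i. a i * b i)" for a b
    using assoc_mult_mat[OF T mat_diag_dim mat_diag_dim, of a b] by simp
  show "u \<bullet> (transpose_mat (Lg D e g) * SJg D g * Wg D g *\<^sub>v x) =
      mortar_pairing D e g u (\<lambda>i. x $ i)"
    "u \<bullet> (transpose_mat (Lg D e g) * Nxg D e g * SJg D g * Wg D g *\<^sub>v x) =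
      mortar_pairing D e g u (\<lambda>i. n_x D e g i * x $ i)"
    "u \<bullet> (transpose_mat (Lg D e g) * Nyg D e g * SJg D g * Wg D g *\<^sub>v x) =
      mortar_pairing D e g u (\<lambda>i. n_y D e g i * x $ i)"
    unfolding SJg_def Wg_def Nxg_def Nyg_def 2
      scalar_prod_transpose_mult_diag[OF Lg_carrier assms] mortar_pairing_def
    by (simp_all only: mult_ac)
qed

lemma scalar_prod_mortar_sum:
  assumes "u \<in> carrier_vec (ndof D e)"
    and "\<And>g. g \<in> mortars_of D e \<Longrightarrow> f g \<in> carrier_vec (ndof D e)"
  shows "u \<bullet> mortar_sum D e f = (\<Sum>g\<in>mortars_of D e. u \<bullet> f g)"
proof -
  have "u \<bullet> mortar_sum D e f = (\<Sum>k\<in>{0..<ndof D e}. \<Sum>g\<in>mortars_of D e. u $ k * f g $ k)"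
    by (simp add: scalar_prod_def mortar_sum_def sum_distrib_left)
  also have "\<dots> = (\<Sum>g\<in>mortars_of D e. \<Sum>k\<in>{0..<ndof D e}. u $ k * f g $ k)"
    by (rule sum.swap)
  also have "\<dots> = (\<Sum>g\<in>mortars_of D e. u \<bullet> f g)"
    using carrier_vecD[OF assms(2)] by (intro sum.cong) (simp_all add: scalar_prod_def)
  finally show ?thesis .
qed

lemma flux_index:
  assumes "i < nmort D g"
  shows "p_minus D p e g $ i = (Lg D e g *\<^sub>v p e) $ i"
    and "p_plus D p e g $ i = (Lg D (other D e g) g *\<^sub>v p (other D e g)) $ i"
    and "vn_minus D vx vy e g $ i =
      n_x D e g i * (Lg D e g *\<^sub>v vx e) $ i + n_y D e g i * (Lg D e g *\<^sub>v vy e) $ i"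
    and "vn_plus D vx vy e g $ i =
      n_x D e g i * (Lg D (other D e g) g *\<^sub>v vx (other D e g)) $ i +
      n_y D e g i * (Lg D (other D e g) g *\<^sub>v vy (other D e g)) $ i"
    and "p_star D p vx vy e g $ i =
      (p_plus D p e g $ i + p_minus D p e g $ i) / 2 -
      alpha D / 2 * (vn_plus D vx vy e g $ i - vn_minus D vx vy e g $ i)"
    and "vn_star D p vx vy e g $ i =
      (vn_plus D vx vy e g $ i + vn_minus D vx vy e g $ i) / 2 -
      alpha D / 2 * (p_plus D p e g $ i - p_minus D p e g $ i)"
proof -
  have c: "Lg D e' g *\<^sub>v u \<in> carrier_vec (nmort D g)" for e' u
    by (rule carrier_vecI) (simp add: Lg_def)
  have dims [simp]: "dim_vec (p_minus D p e g) = nmort D g" "dim_vec (p_plus D p e g) = nmort D g"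
    "dim_vec (vn_minus D vx vy e g) = nmort D g" "dim_vec (vn_plus D vx vy e g) = nmort D g"
    by (simp_all add: p_minus_def p_plus_def vn_minus_def vn_plus_def Lg_def Nyg_def mat_diag_def)
  show "p_minus D p e g $ i = (Lg D e g *\<^sub>v p e) $ i"
    "p_plus D p e g $ i = (Lg D (other D e g) g *\<^sub>v p (other D e g)) $ i"
    by (simp_all add: p_minus_def p_plus_def)
  show "vn_minus D vx vy e g $ i =
      n_x D e g i * (Lg D e g *\<^sub>v vx e) $ i + n_y D e g i * (Lg D e g *\<^sub>v vy e) $ i"
    using assms by (simp add: vn_minus_def Nxg_def Nyg_def mat_diag_mult_vec_index[OF c]
        mat_diag_dim[THEN carrier_matD(1)]
        del: index_mult_mat_vec)
  show "vn_plus D vx vy e g $ i =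
      n_x D e g i * (Lg D (other D e g) g *\<^sub>v vx (other D e g)) $ i +
      n_y D e g i * (Lg D (other D e g) g *\<^sub>v vy (other D e g)) $ i"
    using assms by (simp add: vn_plus_def Nxg_def Nyg_def mat_diag_mult_vec_index[OF c]
        mat_diag_dim[THEN carrier_matD(1)]
        del: index_mult_mat_vec)
  show "p_star D p vx vy e g $ i =
      (p_plus D p e g $ i + p_minus D p e g $ i) / 2 -
      alpha D / 2 * (vn_plus D vx vy e g $ i - vn_minus D vx vy e g $ i)"
    "vn_star D p vx vy e g $ i =
      (vn_plus D vx vy e g $ i + vn_minus D vx vy e g $ i) / 2 -
      alpha D / 2 * (p_plus D p e g $ i - p_minus D p e g $ i)"
    using assms by (simp_all add: p_star_def vn_star_def)
qed

lemma flux_carrier: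
  "vn_minus D vx vy e g \<in> carrier_vec (nmort D g)"
  "p_star D p vx vy e g \<in> carrier_vec (nmort D g)"
  "vn_star D p vx vy e g \<in> carrier_vec (nmort D g)"
  by (rule carrier_vecI; simp add: p_star_def vn_star_def p_minus_def p_plus_def
      vn_minus_def vn_plus_def Lg_def Nyg_def mat_diag_def)+

text \<open>
  In the velocity equations the transposed stiffness matrices move onto \<open>u\<close>. Hence \<open>u = 1\<close> removes
  their volume terms, and an arbitrary \<open>u\<close> brings them into the form of the divergence theorem
  if \<open>p\<close> is constant.
\<close>

lemma weak_form:
  assumes s: "scheme D p vx vy dp dvx dvy" and e: "e \<in> elements D"
    and u: "u \<in> carrier_vec (ndof D e)"
  shows "u \<bullet> (M_J D e *\<^sub>v dp e) = - (u \<bullet> (S_x D e *\<^sub>v vx e)) - u \<bullet> (S_y D e *\<^sub>v vy e) -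
      (\<Sum>g\<in>mortars_of D e.
        mortar_pairing D e g u (\<lambda>i. vn_star D p vx vy e g $ i - vn_minus D vx vy e g $ i))"
    and "u \<bullet> (M_J D e *\<^sub>v dvx e) = (S_x D e *\<^sub>v u) \<bullet> p e -
      (\<Sum>g\<in>mortars_of D e. mortar_pairing D e g u (\<lambda>i. n_x D e g i * p_star D p vx vy e g $ i))"
    and "u \<bullet> (M_J D e *\<^sub>v dvy e) = (S_y D e *\<^sub>v u) \<bullet> p e -
      (\<Sum>g\<in>mortars_of D e. mortar_pairing D e g u (\<lambda>i. n_y D e g i * p_star D p vx vy e g $ i))"
proof -
  let ?n = "ndof D e"
  have car: "p e \<in> carrier_vec ?n" "vx e \<in> carrier_vec ?n" "vy e \<in> carrier_vec ?n"
    "dp e \<in> carrier_vec ?n" "dvx e \<in> carrier_vec ?n" "dvy e \<in> carrier_vec ?n"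
    and eqs: "M_J D e *\<^sub>v dp e + S_x D e *\<^sub>v vx e + S_y D e *\<^sub>v vy e =
          - mortar_sum D e (\<lambda>g. transpose_mat (Lg D e g) * SJg D g * Wg D g *\<^sub>v
              (vn_star D p vx vy e g - vn_minus D vx vy e g))"
      "M_J D e *\<^sub>v dvx e - transpose_mat (S_x D e) *\<^sub>v p e =
          - mortar_sum D e (\<lambda>g. transpose_mat (Lg D e g) * Nxg D e g * SJg D g * Wg D g *\<^sub>v
              p_star D p vx vy e g)"
      "M_J D e *\<^sub>v dvy e - transpose_mat (S_y D e) *\<^sub>v p e =
          - mortar_sum D e (\<lambda>g. transpose_mat (Lg D e g) * Nyg D e g * SJg D g * Wg D g *\<^sub>v
              p_star D p vx vy e g)"
    using s e by (auto simp: scheme_def)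
  have mv: "A *\<^sub>v x \<in> carrier_vec ?n" if "A \<in> carrier_mat ?n ?n" "x \<in> carrier_vec ?n"
    for A :: "real Matrix.mat" and x
    using that by (rule mult_mat_vec_carrier)
  have rhs: "u \<bullet> - mortar_sum D e f = - (\<Sum>g\<in>mortars_of D e. u \<bullet> f g)"
    if "\<And>g. f g \<in> carrier_vec ?n" for f
    using scalar_prod_mortar_sum[OF u that] u by (simp add: mortar_sum_def)
  have tr: "u \<bullet> (transpose_mat A *\<^sub>v x) = (A *\<^sub>v u) \<bullet> x"
    if "A \<in> carrier_mat ?n ?n" "x \<in> carrier_vec ?n" for A :: "real Matrix.mat" and x
  proof -
    have "u \<bullet> (transpose_mat A *\<^sub>v x) = (transpose_mat A *\<^sub>v x) \<bullet> u"
      by (rule comm_scalar_prod[OF u mv]) (use that in auto)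
    also have "\<dots> = x \<bullet> (A *\<^sub>v u)"
      by (rule transpose_vec_mult_scalar[OF that(1) u that(2)])
    also have "\<dots> = (A *\<^sub>v u) \<bullet> x"
      by (rule comm_scalar_prod[OF that(2) mv[OF that(1) u]])
    finally show ?thesis .
  qed
  have lift: "transpose_mat (Lg D e g) * A * B *\<^sub>v x \<in> carrier_vec ?n"
    "transpose_mat (Lg D e g) * A * B * C *\<^sub>v x \<in> carrier_vec ?n" for g A B C x
    by (rule carrier_vecI; simp add: Lg_def)+
  have "u \<bullet> (M_J D e *\<^sub>v dp e) + u \<bullet> (S_x D e *\<^sub>v vx e) + u \<bullet> (S_y D e *\<^sub>v vy e) =
      u \<bullet> (M_J D e *\<^sub>v dp e + S_x D e *\<^sub>v vx e + S_y D e *\<^sub>v vy e)"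
    using u car by (simp add: scalar_prod_add_distrib[of _ ?n] mv)
  also have "\<dots> = - (\<Sum>g\<in>mortars_of D e. mortar_pairing D e g u
        (\<lambda>i. (vn_star D p vx vy e g - vn_minus D vx vy e g) $ i))"
    unfolding eqs(1)
    by (subst rhs) (simp_all add: scalar_prod_mortar_lift[OF u] lift flux_carrier)
  also have "\<dots> = - (\<Sum>g\<in>mortars_of D e. mortar_pairing D e g u
        (\<lambda>i. vn_star D p vx vy e g $ i - vn_minus D vx vy e g $ i))"
    using carrier_vecD[OF flux_carrier(1), of D vx vy e]
    by (auto simp: mortar_pairing_def simp del: index_mult_mat_vec intro!: sum.cong)
  finally show "u \<bullet> (M_J D e *\<^sub>v dp e) = - (u \<bullet> (S_x D e *\<^sub>v vx e)) - u \<bullet> (S_y D e *\<^sub>v vy e) -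
      (\<Sum>g\<in>mortars_of D e.
        mortar_pairing D e g u (\<lambda>i. vn_star D p vx vy e g $ i - vn_minus D vx vy e g $ i))"
    by simp
  have "u \<bullet> (M_J D e *\<^sub>v dvx e) - (S_x D e *\<^sub>v u) \<bullet> p e =
      u \<bullet> (M_J D e *\<^sub>v dvx e - transpose_mat (S_x D e) *\<^sub>v p e)"
    using u car by (simp add: scalar_prod_minus_distrib[of _ ?n] mv tr)
  also have "\<dots> = - (\<Sum>g\<in>mortars_of D e. mortar_pairing D e g u
        (\<lambda>i. n_x D e g i * p_star D p vx vy e g $ i))"
    unfolding eqs(2)
    by (subst rhs) (simp_all add: scalar_prod_mortar_lift[OF u] lift flux_carrier)
  finally show "u \<bullet> (M_J D e *\<^sub>v dvx e) = (S_x D e *\<^sub>v u) \<bullet> p e -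
      (\<Sum>g\<in>mortars_of D e. mortar_pairing D e g u (\<lambda>i. n_x D e g i * p_star D p vx vy e g $ i))"
    by simp
  have "u \<bullet> (M_J D e *\<^sub>v dvy e) - (S_y D e *\<^sub>v u) \<bullet> p e =
      u \<bullet> (M_J D e *\<^sub>v dvy e - transpose_mat (S_y D e) *\<^sub>v p e)"
    using u car by (simp add: scalar_prod_minus_distrib[of _ ?n] mv tr)
  also have "\<dots> = - (\<Sum>g\<in>mortars_of D e. mortar_pairing D e g u
        (\<lambda>i. n_y D e g i * p_star D p vx vy e g $ i))"
    unfolding eqs(3)
    by (subst rhs) (simp_all add: scalar_prod_mortar_lift[OF u] lift flux_carrier)
  finally show "u \<bullet> (M_J D e *\<^sub>v dvy e) = (S_y D e *\<^sub>v u) \<bullet> p e -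
      (\<Sum>g\<in>mortars_of D e. mortar_pairing D e g u (\<lambda>i. n_y D e g i * p_star D p vx vy e g $ i))"
    by simp
qed

lemma divergence_eq_mortar_flux:
  assumes "discrete_divergence_theorem D e" "surface_consistency D e"
    and "u \<in> carrier_vec (ndof D e)" "w \<in> carrier_vec (ndof D e)"
  shows "ones (ndof D e) \<bullet> (S_x D e *\<^sub>v u) + ones (ndof D e) \<bullet> (S_y D e *\<^sub>v w) =
    (\<Sum>g\<in>mortars_of D e. mortar_pairing D e g (ones (ndof D e))
       (\<lambda>i. vn_minus D (\<lambda>_. u) (\<lambda>_. w) e g $ i))"
proof -
  have "ones (ndof D e) \<bullet> (S_x D e *\<^sub>v u) + ones (ndof D e) \<bullet> (S_y D e *\<^sub>v w) =
      surface_flux D e u w"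
    using assms(1,3,4) unfolding discrete_divergence_theorem_def by blast
  also have "\<dots> = (\<Sum>g\<in>mortars_of D e. ones (ndof D e) \<bullet>
      (transpose_mat (Lg D e g) * SJg D g * Wg D g *\<^sub>v vn_minus D (\<lambda>_. u) (\<lambda>_. w) e g))"
    using assms(2-4) unfolding surface_consistency_def by blast
  finally show ?thesis
    unfolding scalar_prod_mortar_lift(1)[OF ones_carrier flux_carrier(1)] .
qed

section \<open>Pairs of elements at a mortar element\<close>

lemma other_props:
  assumes "valid_discretization D" "e \<in> elements D" "g \<in> mortars_of D e"
  shows "other D e g \<in> elements D" "g \<in> mortars_of D (other D e g)"
    and "other D (other D e g) g = e"
    and "{e'\<in>elements D. g \<in> mortars_of D e'} = {e, other D e g}" "other D e g \<noteq> e"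
proof -
  have m: "periodic_mesh D" using assms by (simp add: valid_discretization_def)
  then have "g \<in> mortars D" using periodic_meshD(4) assms(2,3) by blast
  then have "card {e'\<in>elements D. g \<in> mortars_of D e'} = 2"
    using periodic_meshD(5)[OF m] by blast
  then obtain a b where ab: "{e'\<in>elements D. g \<in> mortars_of D e'} = {a, b}" "a \<noteq> b"
    by (auto simp: card_2_iff)
  have "e \<in> {e'\<in>elements D. g \<in> mortars_of D e'}"
    using assms(2,3) by simp
  then have "e = a \<or> e = b"
    unfolding ab(1) by simp
  then obtain e' where e': "{x\<in>elements D. g \<in> mortars_of D x} = {e, e'}" "e' \<noteq> e"
    using ab by (metis insert_commute)
  have mem: "x \<in> elements D \<and> g \<in> mortars_of D x \<longleftrightarrow> x = e \<or> x = e'" for x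
    using e'(1) by blast
  have 1: "other D e g = e'"
    unfolding other_def by (rule the_equality) (use mem e'(2) in auto)
  have 2: "other D e' g = e"
    unfolding other_def by (rule the_equality) (use mem e'(2) in auto)
  show "other D e g \<in> elements D" "g \<in> mortars_of D (other D e g)"
    using mem[of e'] by (simp_all add: 1)
  show "other D (other D e g) g = e"
    "{e'\<in>elements D. g \<in> mortars_of D e'} = {e, other D e g}" "other D e g \<noteq> e"
    using e' by (simp_all add: 1 2)
qed

text \<open>
  Collected by mortar elements, the double sum has exactly two terms for each, one from either side.
\<close>

lemma sum_mortars_cancel:
  fixes F :: "'e \<Rightarrow> 'g \<Rightarrow> real"
  assumes v: "valid_discretization D"
    and F: "\<And>e g. \<lbrakk>e \<in> elements D; g \<in> mortars_of D e\<rbrakk> \<Longrightarrow> F (other D e g) g = - F e g"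
  shows "(\<Sum>e\<in>elements D. \<Sum>g\<in>mortars_of D e. F e g) = 0"
proof -
  have m: "periodic_mesh D" using v by (simp add: valid_discretization_def)
  note fin = periodic_meshD(1,2)[OF m]
  have sub: "mortars_of D e \<subseteq> mortars D" if "e \<in> elements D" for e
    using periodic_meshD(4)[OF m] that by blast
  have "(\<Sum>e\<in>elements D. \<Sum>g\<in>mortars_of D e. F e g) =
      (\<Sum>e\<in>elements D. \<Sum>g\<in>{g\<in>mortars D. g \<in> mortars_of D e}. F e g)"
    using sub by (intro sum.cong refl) auto
  also have "\<dots> = (\<Sum>g\<in>mortars D. \<Sum>e\<in>{e\<in>elements D. g \<in> mortars_of D e}. F e g)"
    by (rule sum.swap_restrict[OF fin])
  also have "\<dots> = 0"
  proof (rule sum.neutral, rule ballI)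
    fix g assume "g \<in> mortars D"
    show "(\<Sum>e\<in>{e\<in>elements D. g \<in> mortars_of D e}. F e g) = 0"
    proof (cases "\<exists>e\<in>elements D. g \<in> mortars_of D e")
      case True
      then obtain e where e: "e \<in> elements D" "g \<in> mortars_of D e" by blast
      show ?thesis
        unfolding other_props(4)[OF v e] using other_props(5)[OF v e] F[OF e] by simp
    qed (auto intro: sum.neutral)
  qed
  finally show ?thesis .
qed

text \<open>
  Reversing the roles of the two elements swaps \<open>p\<^sup>+\<close> with \<open>p\<^sup>-\<close>, and \<open>v\<^sub>n\<^sup>+\<close> with \<open>- v\<^sub>n\<^sup>-\<close>. So the
  average of \<open>p\<close> and the jump of \<open>v\<^sub>n\<close> keep their sign, the other two combinations change it.
\<close>

lemma star_antisym:
  assumes v: "valid_discretization D" and e: "e \<in> elements D" "g \<in> mortars_of D e"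
    and i: "i < nmort D g"
  shows "vn_star D p vx vy (other D e g) g $ i = - vn_star D p vx vy e g $ i"
    and "n_x D (other D e g) g i * p_star D p vx vy (other D e g) g $ i =
      - (n_x D e g i * p_star D p vx vy e g $ i)"
    and "n_y D (other D e g) g i * p_star D p vx vy (other D e g) g $ i =
      - (n_y D e g i * p_star D p vx vy e g $ i)"
proof -
  have n: "n_x D (other D e g) g i = - n_x D e g i" "n_y D (other D e g) g i = - n_y D e g i"
    using v e i by (auto simp: valid_discretization_def mortar_normals_def)
  show "vn_star D p vx vy (other D e g) g $ i = - vn_star D p vx vy e g $ i"
    by (simp add: flux_index[OF i] other_props(3)[OF v e] n field_simps del: index_mult_mat_vec)
  have "p_star D p vx vy (other D e g) g $ i = p_star D p vx vy e g $ i"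
    by (simp add: flux_index[OF i] other_props(3)[OF v e] n field_simps del: index_mult_mat_vec)
  then show "n_x D (other D e g) g i * p_star D p vx vy (other D e g) g $ i =
      - (n_x D e g i * p_star D p vx vy e g $ i)"
    "n_y D (other D e g) g i * p_star D p vx vy (other D e g) g $ i =
      - (n_y D e g i * p_star D p vx vy e g $ i)"
    by (simp_all add: n)
qed

lemma sum_mortar_pairing_ones_cancel:
  assumes v: "valid_discretization D"
    and x: "\<And>e g i. \<lbrakk>e \<in> elements D; g \<in> mortars_of D e; i < nmort D g\<rbrakk> \<Longrightarrow>
      x (other D e g) g i = - x e g i"
  shows "(\<Sum>e\<in>elements D. \<Sum>g\<in>mortars_of D e.
      mortar_pairing D e g (ones (ndof D e)) (x e g)) = 0"
proof (rule sum_mortars_cancel[OF v])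
  fix e g assume e: "e \<in> elements D" "g \<in> mortars_of D e"
  note o = other_props(1,2)[OF v e]
  show "mortar_pairing D (other D e g) g (ones (ndof D (other D e g))) (x (other D e g) g) =
      - mortar_pairing D e g (ones (ndof D e)) (x e g)"
    unfolding mortar_pairing_def Lg_ones[OF v e] Lg_ones[OF v o] sum_negf[symmetric]
    by (rule sum.cong) (use x[OF e] in auto)
qed

section \<open>Conservation and constant preservation\<close>

lemma scheme_conserves:
  assumes v: "valid_discretization D"
    and ddt: "\<forall>e\<in>elements D. discrete_divergence_theorem D e"
    and sc: "\<forall>e\<in>elements D. surface_consistency D e"
    and s: "scheme D p vx vy dp dvx dvy"
  shows "(\<Sum>e\<in>elements D. ones (ndof D e) \<bullet> (M_J D e *\<^sub>v dp e)) = 0"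
    and "(\<Sum>e\<in>elements D. ones (ndof D e) \<bullet> (M_J D e *\<^sub>v dvx e)) = 0"
    and "(\<Sum>e\<in>elements D. ones (ndof D e) \<bullet> (M_J D e *\<^sub>v dvy e)) = 0"
proof -
  have p: "ones (ndof D e) \<bullet> (M_J D e *\<^sub>v dp e) =
      - (\<Sum>g\<in>mortars_of D e. mortar_pairing D e g (ones (ndof D e)) (\<lambda>i. vn_star D p vx vy e g $ i))"
    if e: "e \<in> elements D" for e
  proof -
    have c: "vx e \<in> carrier_vec (ndof D e)" "vy e \<in> carrier_vec (ndof D e)"
      using s e by (auto simp: scheme_def)
    have "vn_minus D (\<lambda>_. vx e) (\<lambda>_. vy e) e g = vn_minus D vx vy e g" for g
      by (simp add: vn_minus_def)
    then show ?thesis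
      using divergence_eq_mortar_flux[of D e "vx e" "vy e"] ddt sc e c
        weak_form(1)[OF s e ones_carrier]
      by (simp add: mortar_pairing_def right_diff_distrib sum_subtractf)
  qed
  have pe: "p e \<in> carrier_vec (ndof D e)" if "e \<in> elements D" for e
    using s that by (auto simp: scheme_def)
  have vx: "ones (ndof D e) \<bullet> (M_J D e *\<^sub>v dvx e) = - (\<Sum>g\<in>mortars_of D e.
      mortar_pairing D e g (ones (ndof D e)) (\<lambda>i. n_x D e g i * p_star D p vx vy e g $ i))"
    and vy: "ones (ndof D e) \<bullet> (M_J D e *\<^sub>v dvy e) = - (\<Sum>g\<in>mortars_of D e.
      mortar_pairing D e g (ones (ndof D e)) (\<lambda>i. n_y D e g i * p_star D p vx vy e g $ i))"
    if e: "e \<in> elements D" for e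
    using weak_form(2,3)[OF s e ones_carrier] pe[OF e] by (simp_all add: S_ones[OF v e])
  show "(\<Sum>e\<in>elements D. ones (ndof D e) \<bullet> (M_J D e *\<^sub>v dp e)) = 0"
    using sum_mortar_pairing_ones_cancel[OF v, of "\<lambda>e g i. vn_star D p vx vy e g $ i"]
    by (simp add: p sum_negf star_antisym[OF v])
  show "(\<Sum>e\<in>elements D. ones (ndof D e) \<bullet> (M_J D e *\<^sub>v dvx e)) = 0"
    using sum_mortar_pairing_ones_cancel[OF v, of "\<lambda>e g i. n_x D e g i * p_star D p vx vy e g $ i"]
    by (simp add: vx sum_negf star_antisym[OF v])
  show "(\<Sum>e\<in>elements D. ones (ndof D e) \<bullet> (M_J D e *\<^sub>v dvy e)) = 0"
    using sum_mortar_pairing_ones_cancel[OF v, of "\<lambda>e g i. n_y D e g i * p_star D p vx vy e g $ i"]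
    by (simp add: vy sum_negf star_antisym[OF v])
qed

lemma constant_state_fluxes:
  assumes v: "valid_discretization D" and e: "e \<in> elements D" "g \<in> mortars_of D e"
    and i: "i < nmort D g"
    and const: "\<forall>e\<in>elements D. p e = \<beta> \<cdot>\<^sub>v ones (ndof D e) \<and> vx e = \<gamma>x \<cdot>\<^sub>v ones (ndof D e) \<and>
           vy e = \<gamma>y \<cdot>\<^sub>v ones (ndof D e)"
  shows "p_star D p vx vy e g $ i = \<beta>" and "vn_star D p vx vy e g $ i = vn_minus D vx vy e g $ i"
proof -
  have L: "(Lg D e' g *\<^sub>v (c \<cdot>\<^sub>v ones (ndof D e'))) $ i = c"
    if "e' \<in> elements D" "g \<in> mortars_of D e'" for e' c
    unfolding mult_mat_vec[OF Lg_carrier ones_carrier] Lg_ones[OF v that]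
    using i by (simp add: ones_def)
  note o = other_props(1,2)[OF v e]
  have "p e = \<beta> \<cdot>\<^sub>v ones (ndof D e)" "vx e = \<gamma>x \<cdot>\<^sub>v ones (ndof D e)" "vy e = \<gamma>y \<cdot>\<^sub>v ones (ndof D e)"
    "p (other D e g) = \<beta> \<cdot>\<^sub>v ones (ndof D (other D e g))"
    "vx (other D e g) = \<gamma>x \<cdot>\<^sub>v ones (ndof D (other D e g))"
    "vy (other D e g) = \<gamma>y \<cdot>\<^sub>v ones (ndof D (other D e g))"
    using const e(1) o(1) by auto
  note const' = this
  show "p_star D p vx vy e g $ i = \<beta>" "vn_star D p vx vy e g $ i = vn_minus D vx vy e g $ i"
    by (simp_all add: flux_index[OF i] const' L[OF e] L[OF o] del: index_mult_mat_vec)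
qed

lemma vec_eq_0_if_orthogonal:
  fixes x :: "real Matrix.vec"
  assumes "x \<in> carrier_vec n" "\<And>u. u \<in> carrier_vec n \<Longrightarrow> u \<bullet> x = 0"
  shows "x = 0\<^sub>v n"
proof (rule eq_vecI)
  fix i assume "i < dim_vec (0\<^sub>v n :: real Matrix.vec)"
  then show "x $ i = 0\<^sub>v n $ i"
    using assms(2)[of "unit_vec n i"] assms(1) by simp
qed (use assms in auto)

text \<open>
  Constant pressure: the surface term is \<open>\<beta>\<close> times the transpose of the mortar flux, which the
  summation-by-parts rule with one velocity component set to zero identifies with \<open>\<beta> S\<^sup>T 1\<close>.
\<close>

lemma mortar_flux_dual:
  assumes v: "valid_discretization D" and e: "e \<in> elements D"
    and d: "discrete_divergence_theorem D e" "surface_consistency D e"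
    and u: "u \<in> carrier_vec (ndof D e)"
  shows "(\<Sum>g\<in>mortars_of D e. mortar_pairing D e g u (\<lambda>i. n_x D e g i * \<beta>)) =
      \<beta> * (ones (ndof D e) \<bullet> (S_x D e *\<^sub>v u))"
    and "(\<Sum>g\<in>mortars_of D e. mortar_pairing D e g u (\<lambda>i. n_y D e g i * \<beta>)) =
      \<beta> * (ones (ndof D e) \<bullet> (S_y D e *\<^sub>v u))"
proof -
  let ?n = "ndof D e" and ?z = "0\<^sub>v (ndof D e) :: real Matrix.vec"
  have z: "ones ?n \<bullet> ?z = 0"
    by (rule scalar_prod_right_zero) simp
  have "mortar_pairing D e g u (\<lambda>i. n_x D e g i * \<beta>) =
      \<beta> * mortar_pairing D e g (ones ?n) (\<lambda>i. vn_minus D (\<lambda>_. u) (\<lambda>_. ?z) e g $ i)"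
    "mortar_pairing D e g u (\<lambda>i. n_y D e g i * \<beta>) =
      \<beta> * mortar_pairing D e g (ones ?n) (\<lambda>i. vn_minus D (\<lambda>_. ?z) (\<lambda>_. u) e g $ i)"
    if "g \<in> mortars_of D e" for g
    unfolding mortar_pairing_def sum_distrib_left Lg_ones[OF v e that]
    by (rule sum.cong; simp add: flux_index mult_mat_zero_vec[OF Lg_carrier] ones_def
        del: index_mult_mat_vec)+
  then show "(\<Sum>g\<in>mortars_of D e. mortar_pairing D e g u (\<lambda>i. n_x D e g i * \<beta>)) =
      \<beta> * (ones (ndof D e) \<bullet> (S_x D e *\<^sub>v u))"
    "(\<Sum>g\<in>mortars_of D e. mortar_pairing D e g u (\<lambda>i. n_y D e g i * \<beta>)) =
      \<beta> * (ones (ndof D e) \<bullet> (S_y D e *\<^sub>v u))"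
    using divergence_eq_mortar_flux[OF d u zero_carrier_vec]
      divergence_eq_mortar_flux[OF d zero_carrier_vec u]
    by (simp_all add: sum_distrib_left mult_mat_zero_vec[OF S_carrier(1)]
        mult_mat_zero_vec[OF S_carrier(2)] z)
qed

lemma scheme_preserves_constants:
  assumes v: "valid_discretization D"
    and ddt: "\<forall>e\<in>elements D. discrete_divergence_theorem D e"
    and sc: "\<forall>e\<in>elements D. surface_consistency D e"
    and s: "scheme D p vx vy dp dvx dvy"
    and const: "\<forall>e\<in>elements D. p e = \<beta> \<cdot>\<^sub>v ones (ndof D e) \<and> vx e = \<gamma>x \<cdot>\<^sub>v ones (ndof D e) \<and>
           vy e = \<gamma>y \<cdot>\<^sub>v ones (ndof D e)"
    and e: "e \<in> elements D"
  shows "M_J D e *\<^sub>v dp e = 0\<^sub>v (ndof D e)" "M_J D e *\<^sub>v dvx e = 0\<^sub>v (ndof D e)"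
    "M_J D e *\<^sub>v dvy e = 0\<^sub>v (ndof D e)"
proof -
  let ?n = "ndof D e"
  have car: "dp e \<in> carrier_vec ?n" "dvx e \<in> carrier_vec ?n" "dvy e \<in> carrier_vec ?n"
    using s e by (auto simp: scheme_def)
  have c: "p e = \<beta> \<cdot>\<^sub>v ones ?n" "vx e = \<gamma>x \<cdot>\<^sub>v ones ?n" "vy e = \<gamma>y \<cdot>\<^sub>v ones ?n"
    using const e by auto
  note flux = constant_state_fluxes[OF v e _ _ const]
  have p: "mortar_pairing D e g u (\<lambda>i. a i * p_star D p vx vy e g $ i) =
      mortar_pairing D e g u (\<lambda>i. a i * \<beta>)"
    "mortar_pairing D e g u (\<lambda>i. vn_star D p vx vy e g $ i - vn_minus D vx vy e g $ i) = 0"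
    if "g \<in> mortars_of D e" for g u a
    using flux[OF that] by (simp_all add: mortar_pairing_def)
  have z: "c \<cdot>\<^sub>v 0\<^sub>v ?n = (0\<^sub>v ?n :: real Matrix.vec)" for c
    by (rule eq_vecI) simp_all
  have S: "S_x D e *\<^sub>v vx e = 0\<^sub>v ?n" "S_y D e *\<^sub>v vy e = 0\<^sub>v ?n"
    by (simp_all add: c mult_mat_vec[OF S_carrier(1) ones_carrier]
        mult_mat_vec[OF S_carrier(2) ones_carrier] S_ones[OF v e] z)
  have q: "y \<bullet> p e = \<beta> * (ones ?n \<bullet> y)" if "y \<in> carrier_vec ?n" for y
    using that by (simp add: c scalar_prod_smult_distrib[OF that ones_carrier]
        comm_scalar_prod[OF that ones_carrier])
  have Su: "S_x D e *\<^sub>v u \<in> carrier_vec ?n" "S_y D e *\<^sub>v u \<in> carrier_vec ?n"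
    if "u \<in> carrier_vec ?n" for u
    using mult_mat_vec_carrier[OF S_carrier(1) that] mult_mat_vec_carrier[OF S_carrier(2) that]
    by auto
  note dual = mortar_flux_dual[OF v e bspec[OF ddt e] bspec[OF sc e]]
  show "M_J D e *\<^sub>v dp e = 0\<^sub>v ?n"
  proof (rule vec_eq_0_if_orthogonal)
    show "u \<bullet> (M_J D e *\<^sub>v dp e) = 0" if "u \<in> carrier_vec ?n" for u
      using weak_form(1)[OF s e that] that by (simp add: S p)
  qed (rule mult_mat_vec_carrier[OF M_J_carrier car(1)])
  show "M_J D e *\<^sub>v dvx e = 0\<^sub>v ?n"
  proof (rule vec_eq_0_if_orthogonal)
    show "u \<bullet> (M_J D e *\<^sub>v dvx e) = 0" if "u \<in> carrier_vec ?n" for u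
      using weak_form(2)[OF s e that] by (simp add: p dual[OF that] q Su[OF that])
  qed (rule mult_mat_vec_carrier[OF M_J_carrier car(2)])
  show "M_J D e *\<^sub>v dvy e = 0\<^sub>v ?n"
  proof (rule vec_eq_0_if_orthogonal)
    show "u \<bullet> (M_J D e *\<^sub>v dvy e) = 0" if "u \<in> carrier_vec ?n" for u
      using weak_form(3)[OF s e that] by (simp add: p dual[OF that] q Su[OF that])
  qed (rule mult_mat_vec_carrier[OF M_J_carrier car(3)])
qed

theorem theorem4p2:
  fixes D :: "('e, 'g) discretization"
  assumes "valid_discretization D"
    and "\<forall>e\<in>elements D. discrete_divergence_theorem D e"
    and "\<forall>e\<in>elements D. surface_consistency D e"
  shows "conservative D \<and> constant_preserving D"
proof
  show "conservative D"
    unfolding conservative_def solution_def by (auto intro: scheme_conserves[OF assms])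
  show "constant_preserving D"
    unfolding constant_preserving_def
    by (intro allI impI ballI conjI; elim conjE; rule scheme_preserves_constants[OF assms])
qed

end
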